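(* Let $(E,\mathcal{E},m)$ be a probability space, $S:E\to E$ a bimeasurable bijection preserving $m$, and $p:E\to(0,1)$ a measurable map; put $q:=1-p$. For $e\in E$, let $P_e$ be the law of the nearest-neighbour random walk $X=\{X_k\,;\,k\ge 0\}$ on $\mathbb{Z}$ in the environment $e$, started from $X_0=0$, and let $E_e$ be the expectation under $P_e$. For fixed $u\in(0,1)$ and for $n\ge 0$, let $$f[n](e):=E_e\bigl(u^{\tau_1}\,:\,\tau_1<\tau_{-n-1}\bigr),\qquad f'[n](e):=E_e\bigl(u^{\tau_{-1}}\,:\,\tau_{-1}<\tau_{n+1}\bigr).$$ Then, for every $n\ge 1$, $$f'[n]\cdot \bigl(f[n-1]\circ S^n\bigr)=f'[n-1]\cdot \bigl(f[n]\circ S^n\bigr)$$ as functions on $E$. Moreover, if $\log(p/q)$ is $m$-integrable, then for every $n\ge 0$ the functions $\log f[n]$ and $\log f'[n]$ are $m$-integrable, and $$\langle\log f[n]\rangle=\langle\log f'[n]\rangle+\langle\log(p/q)\rangle.$$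
   Context: Random walk in random environment on $\mathbb{Z}$: for $n\in\mathbb{Z}$ set $p_n:=p\circ S^n$. For each $e\in E$, under $P_e$ the process $X$ is a Markov chain on $\mathbb{Z}$ with $X_0=0$ and, for all $k\ge 0$ and $n\in\mathbb{Z}$, $$P_e(X_{k+1}=n+1\mid X_k=n)=p_n(e)=1-P_e(X_{k+1}=n-1\mid X_k=n).$$ For $n\in\mathbb{Z}$, $\tau_n:=\inf\{k\ge 1\,;\,X_k=n\}$ is the first passage time at $n$ (with $\inf\emptyset=+\infty$). The notation $E_e(Y:A)$ means $E_e(Y\mathbf{1}_A)$. The notation $\langle\,\cdot\,\rangle$ denotes the expectation (integral) with respect to $m$. The map $S$ is not assumed to be ergodic. *)

theory Defs
  imports "HOL-Probability.Probability"
begin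

definition measure_automorphism :: "'e measure \<Rightarrow> ('e \<Rightarrow> 'e) \<Rightarrow> bool" where
  "measure_automorphism m S \<longleftrightarrow>
     bij_betw S (space m) (space m) \<and>
     S \<in> measurable m m \<and>
     inv_into (space m) S \<in> measurable m m \<and>
     distr m m S = m"

definition int_iterate :: "'e set \<Rightarrow> ('e \<Rightarrow> 'e) \<Rightarrow> int \<Rightarrow> 'e \<Rightarrow> 'e" where
  "int_iterate E S n = (if 0 \<le> n then S ^^ nat n else inv_into E S ^^ nat (- n))"

(* Markov property with respect to the full history, required only for histories of positive
   probability, since cond_prob is 0 when one conditions on a null event. *)
definition markov_chain ::
    "'w measure \<Rightarrow> (nat \<Rightarrow> 'w \<Rightarrow> int) \<Rightarrow> int \<Rightarrow> (int \<Rightarrow> int \<Rightarrow> real) \<Rightarrow> bool" where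
  "markov_chain M X x0 T \<longleftrightarrow>
     prob_space M \<and>
     (\<forall>k. X k \<in> measurable M (count_space UNIV)) \<and>
     (AE \<omega> in M. X 0 \<omega> = x0) \<and>
     (\<forall>k x y. \<P>(\<omega> in M. \<forall>i\<le>k. X i \<omega> = x i) > 0 \<longrightarrow>
        \<P>(\<omega> in M. X (Suc k) \<omega> = y \<bar> \<forall>i\<le>k. X i \<omega> = x i) = T (x k) y)"

definition nearest_neighbour :: "(int \<Rightarrow> real) \<Rightarrow> int \<Rightarrow> int \<Rightarrow> real" where
  "nearest_neighbour a n l = (if l = n + 1 then a n else if l = n - 1 then 1 - a n else 0)"

(* M is the probability P_e; the underlying space is arbitrary, so the canonical path space with
   the coordinate process is one instance. *)
definition walk_in_environment ::
    "'e measure \<Rightarrow> ('e \<Rightarrow> 'e) \<Rightarrow> ('e \<Rightarrow> real) \<Rightarrow> 'e \<Rightarrow> 'w measure \<Rightarrow> (nat \<Rightarrow> 'w \<Rightarrow> int) \<Rightarrow> bool" where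
  "walk_in_environment m S p e M X \<longleftrightarrow>
     markov_chain M X 0 (nearest_neighbour (\<lambda>n. p (int_iterate (space m) S n e)))"

(* The infimum of the empty set is \<infinity> in enat. *)
definition passage_time :: "(nat \<Rightarrow> 'w \<Rightarrow> int) \<Rightarrow> int \<Rightarrow> 'w \<Rightarrow> enat" where
  "passage_time X n \<omega> = (INF k \<in> {k. 1 \<le> k \<and> X k \<omega> = n}. enat k)"

(* u raised to t, for 0 < u < 1, with the value 0 at t = \<infinity>. *)
definition epower :: "real \<Rightarrow> enat \<Rightarrow> real" where
  "epower u t = (case t of enat k \<Rightarrow> u ^ k | \<infinity> \<Rightarrow> 0)"

definition exit_right ::
    "('e \<Rightarrow> 'w measure) \<Rightarrow> (nat \<Rightarrow> 'w \<Rightarrow> int) \<Rightarrow> real \<Rightarrow> nat \<Rightarrow> 'e \<Rightarrow> real" where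
  "exit_right P X u n e =
     (LINT \<omega>:{\<omega>. passage_time X 1 \<omega> < passage_time X (- int n - 1) \<omega>}|P e.
        epower u (passage_time X 1 \<omega>))"

definition exit_left ::
    "('e \<Rightarrow> 'w measure) \<Rightarrow> (nat \<Rightarrow> 'w \<Rightarrow> int) \<Rightarrow> real \<Rightarrow> nat \<Rightarrow> 'e \<Rightarrow> real" where
  "exit_left P X u n e =
     (LINT \<omega>:{\<omega>. passage_time X (- 1) \<omega> < passage_time X (int n + 1) \<omega>}|P e.
        epower u (passage_time X (- 1) \<omega>))"

end

theory Submission
  imports Defs
begin

text \<open>
  Fix an environment and call \<open>h\<close> \<^emph>\<open>u-harmonic\<close> at a site \<open>x\<close> if \<open>h x = u * (p\<^sub>x * h (x + 1) + q\<^sub>x * h (x - 1))\<close>.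
  If \<open>h\<close> is u-harmonic strictly between \<open>b\<close> and \<open>c\<close> and \<open>h c = 0\<close>, then \<open>u ^ k * h (X k)\<close>, stopped on
  leaving the open interval, has constant expectation. As \<open>h\<close> is bounded there and \<open>u < 1\<close>, letting
  \<open>k\<close> tend to infinity leaves only the exits at \<open>b\<close>, so that
  \<open>E (u ^ \<tau>\<^sub>b : \<tau>\<^sub>b < \<tau>\<^sub>c) * h b = h (X 0)\<close> (lemma \<open>exit_transform_harmonic\<close>). This needs the
  Markov property for one step only: no walk has to be restarted at a hitting time, and no walk
  started away from the origin has to be constructed.

  The u-harmonic functions to the right of a site form a plane, spanned by \<open>\<phi>\<close> with
  \<open>\<phi> (- 1) = 0\<close>, \<open>\<phi> 0 = 1\<close> and \<open>\<psi>\<close> with \<open>\<psi> (- 1) = 1\<close>, \<open>\<psi> 0 = 0\<close>, both read in the environment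
  \<open>e\<close>. The walk in the environment \<open>S ^ n e\<close> is, up to a translation by \<open>n\<close>, the walk in \<open>e\<close> started at \<open>n\<close>. Hence all four
  functions in the exchange identity are quotients of values of \<open>\<phi>\<close> and \<open>\<psi>\<close>:
  \<open>f[n] (S ^ n e) = \<phi> n / \<phi> (n + 1)\<close>, as \<open>\<phi>\<close> vanishes at \<open>- 1\<close>;
  \<open>f[n - 1] (S ^ n e) * \<psi> (n + 1) = \<psi> n\<close>, as \<open>\<psi>\<close> vanishes at \<open>0\<close>; and
  \<open>f'[n] (e) = - \<psi> (n + 1) / \<phi> (n + 1)\<close>, because \<open>\<phi> (n + 1) * \<psi> - \<psi> (n + 1) * \<phi>\<close> vanishes at
  \<open>n + 1\<close>. Both sides of the identity are therefore \<open>- \<psi> n / \<phi> (n + 1)\<close> (lemma \<open>exit_exchange\<close>).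

  The same quotients show that \<open>f[n]\<close> and \<open>f'[n]\<close> are measurable in the environment. Looking at the
  first step alone gives \<open>u * p \<le> f[n] \<le> 1\<close> and \<open>u * q \<le> f'[n] \<le> 1\<close>, and since \<open>max p q \<ge> 1/2\<close>, integrability
  of \<open>log (p/q)\<close> passes to the logarithms. Taking the logarithm of the identity, integrating and
  using the invariance of \<open>m\<close> under \<open>S ^ n\<close> shows that \<open>\<langle>log f[n]\<rangle> - \<langle>log f'[n]\<rangle>\<close> does not depend on \<open>n\<close>;
  for \<open>n = 0\<close> the functions are \<open>u * p\<close> and \<open>u * q\<close>.
\<close>

section \<open>Markov chains killed outside a finite set\<close>

text \<open>
  The Markov property is given for complete histories. The event that the chain has stayed in the
  finite set \<open>I\<close> and is now at \<open>x\<close> is a finite disjoint union of such histories, all of which lead on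
  to \<open>y\<close> with the same probability.
\<close>

lemma markov_one_step:
  assumes mc: "markov_chain M X x0 T" and "finite I"
  shows "measure M {\<omega>\<in>space M. (\<forall>i\<le>k. X i \<omega> \<in> I) \<and> X k \<omega> = x \<and> X (Suc k) \<omega> = y} =
         measure M {\<omega>\<in>space M. (\<forall>i\<le>k. X i \<omega> \<in> I) \<and> X k \<omega> = x} * T x y"
proof -
  interpret prob_space M using mc by (simp add: markov_chain_def)
  have [measurable]: "X i \<in> measurable M (count_space UNIV)" for i
    using mc by (simp add: markov_chain_def)
  define H where "H = {h \<in> PiE {..k} (\<lambda>_. I). h k = x}"
  have fin: "finite H"
    unfolding H_def using \<open>finite I\<close> by (auto intro!: finite_subset[OF _ finite_PiE[of "{..k}" "\<lambda>_. I"]])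
  have uniq: "h = h'" if "h \<in> H" "h' \<in> H" "\<forall>i\<le>k. X i \<omega> = h i" "\<forall>i\<le>k. X i \<omega> = h' i" for h h' \<omega>
    using that by (auto simp: H_def intro!: PiE_ext[of h "{..k}" "\<lambda>_. I" h'])
  have hist: "(\<exists>h\<in>H. \<forall>i\<le>k. X i \<omega> = h i) \<longleftrightarrow> (\<forall>i\<le>k. X i \<omega> \<in> I) \<and> X k \<omega> = x" for \<omega>
  proof
    assume "(\<forall>i\<le>k. X i \<omega> \<in> I) \<and> X k \<omega> = x"
    then show "\<exists>h\<in>H. \<forall>i\<le>k. X i \<omega> = h i"
      by (intro bexI[of _ "\<lambda>i\<in>{..k}. X i \<omega>"]) (auto simp: H_def)
  qed (auto simp: H_def PiE_iff)
  have decomp: "measure M {\<omega>\<in>space M. (\<forall>i\<le>k. X i \<omega> \<in> I) \<and> X k \<omega> = x \<and> Q \<omega>} =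
      (\<Sum>h\<in>H. measure M {\<omega>\<in>space M. (\<forall>i\<le>k. X i \<omega> = h i) \<and> Q \<omega>})"
    if [measurable]: "Measurable.pred M Q" for Q
  proof -
    have "{\<omega>\<in>space M. (\<forall>i\<le>k. X i \<omega> \<in> I) \<and> X k \<omega> = x \<and> Q \<omega>} =
        (\<Union>h\<in>H. {\<omega>\<in>space M. (\<forall>i\<le>k. X i \<omega> = h i) \<and> Q \<omega>})"
      using hist by blast
    moreover have "disjoint_family_on (\<lambda>h. {\<omega>\<in>space M. (\<forall>i\<le>k. X i \<omega> = h i) \<and> Q \<omega>}) H"
      using uniq by (auto simp: disjoint_family_on_def)
    ultimately show ?thesis
      by (simp only:) (rule finite_measure_finite_Union[OF fin], auto)
  qed
  have step: "measure M {\<omega>\<in>space M. (\<forall>i\<le>k. X i \<omega> = h i) \<and> X (Suc k) \<omega> = y} =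
      measure M {\<omega>\<in>space M. \<forall>i\<le>k. X i \<omega> = h i} * T x y" if "h \<in> H" for h
  proof (cases "measure M {\<omega>\<in>space M. \<forall>i\<le>k. X i \<omega> = h i} > 0")
    case True
    then have "\<P>(\<omega> in M. X (Suc k) \<omega> = y \<bar> \<forall>i\<le>k. X i \<omega> = h i) = T (h k) y"
      using mc by (simp add: markov_chain_def)
    moreover have "h k = x" using that by (simp add: H_def)
    ultimately show ?thesis
      using True by (simp add: cond_prob_def field_simps conj_commute)
  next
    case False
    then have zero: "measure M {\<omega>\<in>space M. \<forall>i\<le>k. X i \<omega> = h i} = 0"
      by (simp add: zero_less_measure_iff)
    have "measure M {\<omega>\<in>space M. (\<forall>i\<le>k. X i \<omega> = h i) \<and> X (Suc k) \<omega> = y} \<le>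
        measure M {\<omega>\<in>space M. \<forall>i\<le>k. X i \<omega> = h i}"
      by (intro finite_measure_mono) auto
    then show ?thesis using zero by (simp add: measure_le_0_iff)
  qed
  \<comment> \<open>Decompose with and without the condition on the next step, and compare term by term.\<close>
  show ?thesis
    using decomp[of "\<lambda>\<omega>. X (Suc k) \<omega> = y"] decomp[of "\<lambda>_. True"] step
    by (simp add: sum_distrib_right)
qed

lemma markov_killed_step:
  assumes mc: "markov_chain M X x0 T" and "finite I"
  shows "measure M {\<omega>\<in>space M. (\<forall>i\<le>k. X i \<omega> \<in> I) \<and> X (Suc k) \<omega> = y} =
    (\<Sum>x\<in>I. measure M {\<omega>\<in>space M. (\<forall>i\<le>k. X i \<omega> \<in> I) \<and> X k \<omega> = x} * T x y)"
proof -
  interpret prob_space M using mc by (simp add: markov_chain_def)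
  have [measurable]: "X i \<in> measurable M (count_space UNIV)" for i
    using mc by (simp add: markov_chain_def)
  have "{\<omega>\<in>space M. (\<forall>i\<le>k. X i \<omega> \<in> I) \<and> X (Suc k) \<omega> = y} =
      (\<Union>x\<in>I. {\<omega>\<in>space M. (\<forall>i\<le>k. X i \<omega> \<in> I) \<and> X k \<omega> = x \<and> X (Suc k) \<omega> = y})"
    by auto
  also have "measure M \<dots> = (\<Sum>x\<in>I. measure M
      {\<omega>\<in>space M. (\<forall>i\<le>k. X i \<omega> \<in> I) \<and> X k \<omega> = x \<and> X (Suc k) \<omega> = y})"
    using \<open>finite I\<close>
    by (intro finite_measure_finite_Union) (auto simp: disjoint_family_on_def)
  also have "\<dots> = (\<Sum>x\<in>I. measure M {\<omega>\<in>space M. (\<forall>i\<le>k. X i \<omega> \<in> I) \<and> X k \<omega> = x} * T x y)"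
    by (intro sum.cong refl markov_one_step[OF assms])
  finally show ?thesis .
qed

text \<open>
  Both exit functions are instances of one transform, with target \<open>b\<close> and forbidden site \<open>c\<close>; treating
  it for an arbitrary pair avoids a separate reflection argument for exits to the left.
\<close>

definition exit_transform :: "'w measure \<Rightarrow> (nat \<Rightarrow> 'w \<Rightarrow> int) \<Rightarrow> real \<Rightarrow> int \<Rightarrow> int \<Rightarrow> real" where
  "exit_transform M X u b c =
     (LINT \<omega>:{\<omega>. passage_time X b \<omega> < passage_time X c \<omega>}|M. epower u (passage_time X b \<omega>))"

lemma exit_right_eq: "exit_right P X u n e = exit_transform (P e) X u 1 (- int n - 1)"
  and exit_left_eq: "exit_left P X u n e = exit_transform (P e) X u (- 1) (int n + 1)"
  by (simp_all add: exit_right_def exit_left_def exit_transform_def)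

lemma passage_time_le: "1 \<le> k \<Longrightarrow> X k \<omega> = y \<Longrightarrow> passage_time X y \<omega> \<le> enat k"
  unfolding passage_time_def by (intro INF_lower) auto

lemma enat_less_passage_time_iff:
  "enat k < passage_time X y \<omega> \<longleftrightarrow> (\<forall>i. 1 \<le> i \<and> i \<le> k \<longrightarrow> X i \<omega> \<noteq> y)"
proof
  assume *: "enat k < passage_time X y \<omega>"
  show "\<forall>i. 1 \<le> i \<and> i \<le> k \<longrightarrow> X i \<omega> \<noteq> y"
  proof (intro allI impI notI)
    fix i assume i: "1 \<le> i \<and> i \<le> k" "X i \<omega> = y"
    then have "passage_time X y \<omega> \<le> enat k"
      using passage_time_le[of i X \<omega> y] by (meson enat_ord_simps(1) order_trans)
    with * show False by simp
  qed
next
  assume *: "\<forall>i. 1 \<le> i \<and> i \<le> k \<longrightarrow> X i \<omega> \<noteq> y"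
  have "enat (Suc k) \<le> passage_time X y \<omega>"
    unfolding passage_time_def using * by (intro INF_greatest) (auto simp: not_less_eq_eq[symmetric])
  then show "enat k < passage_time X y \<omega>"
    by (simp add: Suc_ile_eq)
qed

lemma passage_time_eq_Suc_iff:
  "passage_time X y \<omega> = enat (Suc k) \<longleftrightarrow> X (Suc k) \<omega> = y \<and> (\<forall>i. 1 \<le> i \<and> i \<le> k \<longrightarrow> X i \<omega> \<noteq> y)"
  (is "?L \<longleftrightarrow> ?R")
proof -
  have "?L \<longleftrightarrow> enat k < passage_time X y \<omega> \<and> \<not> enat (Suc k) < passage_time X y \<omega>"
    by (cases "passage_time X y \<omega>") auto
  also have "\<dots> \<longleftrightarrow> ?R"
    unfolding enat_less_passage_time_iff by (auto simp: le_Suc_eq)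
  finally show ?thesis .
qed

lemma passage_time_neq_0: "passage_time X y \<omega> \<noteq> enat 0"
  using enat_less_passage_time_iff[of 0 X y \<omega>] by force

text \<open>
  On the event of exit through \<open>b\<close> exactly one term of the series is nonzero, otherwise none is. The
  series involves finitely many coordinates per term, which settles all questions of measurability
  of the passage times at once.
\<close>

lemma exit_integrand_sums:
  assumes "b \<noteq> c"
  shows "(\<lambda>k. u ^ Suc k *
            indicat_real {\<omega>. X (Suc k) \<omega> = b \<and> (\<forall>i. 1 \<le> i \<and> i \<le> k \<longrightarrow> X i \<omega> \<noteq> b \<and> X i \<omega> \<noteq> c)} \<omega>)
     sums (indicat_real {\<omega>. passage_time X b \<omega> < passage_time X c \<omega>} \<omega> * epower u (passage_time X b \<omega>))"
proof -
  have ev: "X (Suc k) w = b \<and> (\<forall>i. 1 \<le> i \<and> i \<le> k \<longrightarrow> X i w \<noteq> b \<and> X i w \<noteq> c) \<longleftrightarrow>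
      passage_time X b w = enat (Suc k) \<and> enat (Suc k) < passage_time X c w" for k w
    unfolding passage_time_eq_Suc_iff enat_less_passage_time_iff using assms by (auto simp: le_Suc_eq)
  show ?thesis
  proof (cases "passage_time X b \<omega> < passage_time X c \<omega>")
    case False
    have "(\<lambda>k. u ^ Suc k * indicat_real {\<omega>. X (Suc k) \<omega> = b \<and>
        (\<forall>i. 1 \<le> i \<and> i \<le> k \<longrightarrow> X i \<omega> \<noteq> b \<and> X i \<omega> \<noteq> c)} \<omega>) = (\<lambda>k. 0)"
      unfolding ev using False by (auto simp: fun_eq_iff indicator_def simp del: power_Suc)
    then show ?thesis using False by simp
  next
    case True
    then obtain j where "passage_time X b \<omega> = enat j"
      by (cases "passage_time X b \<omega>") auto
    with passage_time_neq_0[of X b \<omega>] obtain j where j: "passage_time X b \<omega> = enat (Suc j)"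
      by (cases j) auto
    have "(\<lambda>k. u ^ Suc k * indicat_real {\<omega>. X (Suc k) \<omega> = b \<and>
        (\<forall>i. 1 \<le> i \<and> i \<le> k \<longrightarrow> X i \<omega> \<noteq> b \<and> X i \<omega> \<noteq> c)} \<omega>) = (\<lambda>k. if k = j then u ^ Suc k else 0)"
      unfolding ev using True j by (auto simp: fun_eq_iff indicator_def simp del: power_Suc)
    moreover have "(\<lambda>k. if k = j then u ^ Suc k else 0) sums (u ^ Suc j)"
      using sums_single[of j "\<lambda>k. u ^ Suc k"] by simp
    ultimately show ?thesis using True j by (simp add: epower_def)
  qed
qed

lemma markov_stays:
  assumes mc: "markov_chain M X x0 T" and "finite I" and "x0 \<in> I"
    and supp: "\<And>x y. x \<in> I \<Longrightarrow> y \<notin> insert b (insert c I) \<Longrightarrow> T x y = 0"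
  shows "AE \<omega> in M. X 0 \<omega> \<in> I \<and>
      (\<forall>k. (\<forall>i\<le>k. X i \<omega> \<in> I) \<longrightarrow> X (Suc k) \<omega> \<in> insert b (insert c I))"
proof -
  interpret prob_space M using mc by (simp add: markov_chain_def)
  have [measurable]: "X i \<in> measurable M (count_space UNIV)" for i
    using mc by (simp add: markov_chain_def)
  have "AE \<omega> in M. (\<forall>i\<le>k. X i \<omega> \<in> I) \<longrightarrow> X (Suc k) \<omega> \<noteq> y" if "y \<notin> insert b (insert c I)" for k y
  proof -
    have "measure M {\<omega>\<in>space M. (\<forall>i\<le>k. X i \<omega> \<in> I) \<and> X (Suc k) \<omega> = y} = 0"
      unfolding markov_killed_step[OF mc \<open>finite I\<close>] using supp that by simp
    then have "AE \<omega> in M. \<omega> \<notin> {\<omega>\<in>space M. (\<forall>i\<le>k. X i \<omega> \<in> I) \<and> X (Suc k) \<omega> = y}"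
      by (intro AE_not_in) (auto simp: emeasure_eq_measure null_sets_def)
    then show ?thesis using AE_space by eventually_elim blast
  qed
  then have "AE \<omega> in M. \<forall>k. \<forall>y. y \<notin> insert b (insert c I) \<longrightarrow>
      (\<forall>i\<le>k. X i \<omega> \<in> I) \<longrightarrow> X (Suc k) \<omega> \<noteq> y"
    unfolding AE_all_countable by auto
  moreover have "AE \<omega> in M. X 0 \<omega> = x0" using mc by (simp add: markov_chain_def)
  ultimately show ?thesis
    by eventually_elim (use \<open>x0 \<in> I\<close> in blast)
qed

text \<open>
  The first visit to \<open>{b, c}\<close> occurs at time \<open>k + 1\<close> and at \<open>b\<close> if and only if, up to a null set, the
  chain remains in \<open>I\<close> up to time \<open>k\<close> and then jumps to \<open>b\<close>: from \<open>I\<close> it can leave only through \<open>b\<close>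
  or \<open>c\<close>. The series of the corresponding indicators may be integrated termwise since it is
  dominated by a geometric one.
\<close>

lemma exit_transform_sums:
  assumes mc: "markov_chain M X x0 T" and "finite I" and "x0 \<in> I"
    and "b \<notin> I" and "c \<notin> I" and "b \<noteq> c"
    and supp: "\<And>x y. x \<in> I \<Longrightarrow> y \<notin> insert b (insert c I) \<Longrightarrow> T x y = 0"
    and u: "0 < u" "u < 1"
  shows "(\<lambda>k. u ^ Suc k * measure M {\<omega>\<in>space M. (\<forall>i\<le>k. X i \<omega> \<in> I) \<and> X (Suc k) \<omega> = b})
           sums exit_transform M X u b c"
proof -
  interpret prob_space M using mc by (simp add: markov_chain_def)
  have [measurable]: "X i \<in> measurable M (count_space UNIV)" for i
    using mc by (simp add: markov_chain_def)
  \<comment> \<open>The same event twice: \<open>F\<close> is the form in the pointwise expansion, \<open>G\<close> its restriction to the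
    sample space, which is a measurable set.\<close>
  define F where "F k = {\<omega>. X (Suc k) \<omega> = b \<and> (\<forall>i. 1 \<le> i \<and> i \<le> k \<longrightarrow> X i \<omega> \<noteq> b \<and> X i \<omega> \<noteq> c)}" for k
  define G where "G k = {\<omega>\<in>space M. X (Suc k) \<omega> = b \<and> (\<forall>i. 1 \<le> i \<and> i \<le> k \<longrightarrow> X i \<omega> \<noteq> b \<and> X i \<omega> \<noteq> c)}" for k
  have G[measurable]: "G k \<in> sets M" for k unfolding G_def by measurable
  have stays: "AE \<omega> in M. X 0 \<omega> \<in> I \<and>
      (\<forall>k. (\<forall>i\<le>k. X i \<omega> \<in> I) \<longrightarrow> X (Suc k) \<omega> \<in> insert b (insert c I))"
    using supp by (intro markov_stays[OF mc \<open>finite I\<close> \<open>x0 \<in> I\<close>])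
  have meas: "measure M (G k) = measure M {\<omega>\<in>space M. (\<forall>i\<le>k. X i \<omega> \<in> I) \<and> X (Suc k) \<omega> = b}" for k
  proof (rule finite_measure_eq_AE)
    show "AE \<omega> in M. (\<omega> \<in> G k) = (\<omega> \<in> {\<omega>\<in>space M. (\<forall>i\<le>k. X i \<omega> \<in> I) \<and> X (Suc k) \<omega> = b})"
      using stays
    proof eventually_elim
      case (elim \<omega>)
      have "\<forall>i\<le>k. X i \<omega> \<in> I" if avoid: "\<forall>i. 1 \<le> i \<and> i \<le> k \<longrightarrow> X i \<omega> \<noteq> b \<and> X i \<omega> \<noteq> c"
      proof -
        have "j \<le> k \<Longrightarrow> \<forall>i\<le>j. X i \<omega> \<in> I" for j
        proof (induction j)
          case 0
          then show ?case using elim by simp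
        next
          case (Suc j)
          then have "X (Suc j) \<omega> \<in> insert b (insert c I)" using elim by simp
          moreover have "X (Suc j) \<omega> \<noteq> b" "X (Suc j) \<omega> \<noteq> c" using avoid Suc.prems by auto
          ultimately show ?case using Suc by (auto simp: le_Suc_eq)
        qed
        then show ?thesis by blast
      qed
      then show ?case using \<open>b \<notin> I\<close> \<open>c \<notin> I\<close> unfolding G_def by auto
    qed
  qed auto
  have GF: "indicat_real (G k) \<omega> = indicat_real (F k) \<omega>" if "\<omega> \<in> space M" for k \<omega>
    using that by (simp add: G_def F_def indicator_def)
  have bound: "norm (u ^ Suc k * indicat_real (G k) \<omega>) \<le> u ^ Suc k" for k \<omega>
    using u by (auto simp: indicator_def)
  have summ: "summable (\<lambda>k. u ^ Suc k)"
    using u by (subst summable_Suc_iff) (simp add: summable_geometric)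
  have int: "(\<integral>\<omega>. u ^ Suc k * indicat_real (G k) \<omega> \<partial>M) = u ^ Suc k * measure M (G k)" for k
    by (simp del: power_Suc)
  have "(\<lambda>k. \<integral>\<omega>. u ^ Suc k * indicat_real (G k) \<omega> \<partial>M) sums
      (\<integral>\<omega>. (\<Sum>k. u ^ Suc k * indicat_real (G k) \<omega>) \<partial>M)"
  proof (rule sums_integral)
    show "integrable M (\<lambda>\<omega>. u ^ Suc k * indicat_real (G k) \<omega>)" for k
      by (auto simp: less_top[symmetric])
    show "AE \<omega> in M. summable (\<lambda>k. norm (u ^ Suc k * indicat_real (G k) \<omega>))"
      using bound by (intro AE_I2 summable_comparison_test[OF _ summ]) auto
    show "summable (\<lambda>k. \<integral>\<omega>. norm (u ^ Suc k * indicat_real (G k) \<omega>) \<partial>M)"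
    proof (rule summable_comparison_test[OF _ summ], intro exI allI impI)
      fix k
      have "(\<integral>\<omega>. norm (u ^ Suc k * indicat_real (G k) \<omega>) \<partial>M) = u ^ Suc k * measure M (G k)"
        using u by (simp add: abs_mult del: power_Suc)
      then show "norm (\<integral>\<omega>. norm (u ^ Suc k * indicat_real (G k) \<omega>) \<partial>M) \<le> u ^ Suc k"
        using u by (simp add: mult_left_le del: power_Suc)
    qed
  qed
  also have "(\<integral>\<omega>. (\<Sum>k. u ^ Suc k * indicat_real (G k) \<omega>) \<partial>M) = exit_transform M X u b c"
    unfolding exit_transform_def set_lebesgue_integral_def
  proof (rule Bochner_Integration.integral_cong[OF refl])
    fix \<omega> assume "\<omega> \<in> space M"
    then have "(\<Sum>k. u ^ Suc k * indicat_real (G k) \<omega>) = (\<Sum>k. u ^ Suc k * indicat_real (F k) \<omega>)"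
      by (simp add: GF)
    also have "\<dots> = indicat_real {\<omega>. passage_time X b \<omega> < passage_time X c \<omega>} \<omega> *
        epower u (passage_time X b \<omega>)"
      unfolding F_def by (rule sums_unique[symmetric, OF exit_integrand_sums[OF \<open>b \<noteq> c\<close>]])
    finally show "(\<Sum>k. u ^ Suc k * indicat_real (G k) \<omega>) =
        indicat_real {\<omega>. passage_time X b \<omega> < passage_time X c \<omega>} \<omega> *\<^sub>R epower u (passage_time X b \<omega>)"
      by simp
  qed
  finally show ?thesis unfolding int meas .
qed

lemma markov_initial_mass:
  assumes mc: "markov_chain M X x0 T" and "x0 \<in> I"
  shows "measure M {\<omega>\<in>space M. (\<forall>i\<le>0. X i \<omega> \<in> I) \<and> X 0 \<omega> = x} = (if x = x0 then 1 else 0)"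
proof -
  interpret prob_space M using mc by (simp add: markov_chain_def)
  have [measurable]: "X i \<in> measurable M (count_space UNIV)" for i
    using mc by (simp add: markov_chain_def)
  have start: "AE \<omega> in M. X 0 \<omega> = x0" using mc by (simp add: markov_chain_def)
  have "measure M {\<omega>\<in>space M. (\<forall>i\<le>0. X i \<omega> \<in> I) \<and> X 0 \<omega> = x} =
      measure M (if x = x0 then space M else {})"
    by (rule finite_measure_eq_AE) (use start \<open>x0 \<in> I\<close> in \<open>auto\<close>)
  then show ?thesis by (simp add: prob_space)
qed

text \<open>
  Optional stopping in elementary form. With \<open>g k x\<close> the probability of staying in \<open>I\<close> up to time
  \<open>k\<close> and being at \<open>x\<close>, the quantity \<open>V k = u ^ k * (\<Sum>x\<in>I. g k x * h x)\<close> loses in each step exactly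
  what exits through \<open>b\<close>; exits through \<open>c\<close> carry the weight \<open>h c = 0\<close>. It starts at \<open>h x0\<close> and tends
  to \<open>0\<close>, so the losses add up to \<open>h x0\<close>.
\<close>

lemma exit_transform_harmonic:
  assumes mc: "markov_chain M X x0 T" and "finite I" and "x0 \<in> I"
    and "b \<notin> I" and "c \<notin> I" and "b \<noteq> c"
    and supp: "\<And>x y. x \<in> I \<Longrightarrow> y \<notin> insert b (insert c I) \<Longrightarrow> T x y = 0"
    and u: "0 < u" "u < 1"
    and harm: "\<And>x. x \<in> I \<Longrightarrow> h x = u * (\<Sum>y\<in>insert b (insert c I). T x y * h y)"
    and "h c = 0"
  shows "exit_transform M X u b c * h b = h x0"
proof -
  interpret prob_space M using mc by (simp add: markov_chain_def)
  define g where "g k x = measure M {\<omega>\<in>space M. (\<forall>i\<le>k. X i \<omega> \<in> I) \<and> X k \<omega> = x}" for k x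
  define E where "E k = measure M {\<omega>\<in>space M. (\<forall>i\<le>k. X i \<omega> \<in> I) \<and> X (Suc k) \<omega> = b}" for k
  define V where "V k = u ^ k * (\<Sum>x\<in>I. g k x * h x)" for k
  have E: "E k = (\<Sum>x\<in>I. g k x * T x b)" for k
    unfolding E_def g_def by (rule markov_killed_step[OF mc \<open>finite I\<close>])
  have g: "g (Suc k) y = (\<Sum>x\<in>I. g k x * T x y)" if "y \<in> I" for k y
  proof -
    have "{\<omega>\<in>space M. (\<forall>i\<le>Suc k. X i \<omega> \<in> I) \<and> X (Suc k) \<omega> = y} =
        {\<omega>\<in>space M. (\<forall>i\<le>k. X i \<omega> \<in> I) \<and> X (Suc k) \<omega> = y}"
      using that by (auto simp: le_Suc_eq)
    then show ?thesis
      unfolding g_def by (simp only: markov_killed_step[OF mc \<open>finite I\<close>])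
  qed
  have step: "V k = V (Suc k) + u ^ Suc k * E k * h b" for k
  proof -
    have "(\<Sum>x\<in>I. g k x * h x) = (\<Sum>x\<in>I. g k x * (u * ((\<Sum>y\<in>I. T x y * h y) + T x b * h b)))"
      using harm \<open>finite I\<close> \<open>b \<notin> I\<close> \<open>c \<notin> I\<close> \<open>b \<noteq> c\<close> \<open>h c = 0\<close>
      by (intro sum.cong refl) (simp add: algebra_simps)
    also have "\<dots> = u * ((\<Sum>x\<in>I. \<Sum>y\<in>I. g k x * T x y * h y) + (\<Sum>x\<in>I. g k x * T x b) * h b)"
      by (simp add: sum_distrib_left sum_distrib_right sum.distrib algebra_simps)
    also have "(\<Sum>x\<in>I. \<Sum>y\<in>I. g k x * T x y * h y) = (\<Sum>y\<in>I. g (Suc k) y * h y)"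
      by (subst sum.swap) (simp add: g sum_distrib_right)
    finally show ?thesis by (simp add: V_def E algebra_simps)
  qed
  have partial: "(\<Sum>k<n. u ^ Suc k * E k * h b) = V 0 - V n" for n
  proof (induction n)
    case (Suc n)
    then show ?case using step[of n] by simp
  qed simp
  have V0: "V 0 = h x0"
  proof -
    have "g 0 x = (if x = x0 then 1 else 0)" for x
      unfolding g_def using markov_initial_mass[OF mc \<open>x0 \<in> I\<close>] by simp
    then show ?thesis
      using \<open>finite I\<close> \<open>x0 \<in> I\<close> by (simp add: V_def if_distrib[of "\<lambda>t. t * _"] cong: if_cong)
  qed
  have "V \<longlonglongrightarrow> 0"
  proof (rule Lim_null_comparison)
    show "\<forall>\<^sub>F k in sequentially. norm (V k) \<le> u ^ k * (\<Sum>x\<in>I. \<bar>h x\<bar>)"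
    proof (intro always_eventually allI)
      fix k
      have "\<bar>\<Sum>x\<in>I. g k x * h x\<bar> \<le> (\<Sum>x\<in>I. \<bar>g k x * h x\<bar>)" by (rule sum_abs)
      also have "\<dots> \<le> (\<Sum>x\<in>I. \<bar>h x\<bar>)"
        unfolding g_def abs_mult by (intro sum_mono) (simp add: mult_left_le_one_le)
      finally show "norm (V k) \<le> u ^ k * (\<Sum>x\<in>I. \<bar>h x\<bar>)"
        using u by (simp add: V_def abs_mult)
    qed
    show "(\<lambda>k. u ^ k * (\<Sum>x\<in>I. \<bar>h x\<bar>)) \<longlonglongrightarrow> 0"
      using u by (intro tendsto_mult_left_zero LIMSEQ_power_zero) simp
  qed
  then have "(\<lambda>n. \<Sum>k<n. u ^ Suc k * E k * h b) \<longlonglongrightarrow> h x0"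
    unfolding partial V0 using tendsto_diff[OF tendsto_const[of "h x0"]] by fastforce
  then have "(\<lambda>k. u ^ Suc k * E k * h b) sums h x0"
    by (simp add: sums_def)
  moreover have "(\<lambda>k. u ^ Suc k * E k * h b) sums (exit_transform M X u b c * h b)"
    unfolding E_def by (rule sums_mult2[OF exit_transform_sums[OF assms(1-9)]])
  ultimately show ?thesis using sums_unique2 by blast
qed

text \<open>The lower bound is the first term of the series in \<open>exit_transform_sums\<close>: a direct jump from
  \<open>x0\<close> to \<open>b\<close>.\<close>

lemma exit_transform_bounds:
  assumes mc: "markov_chain M X x0 T" and "finite I" and "x0 \<in> I"
    and "b \<notin> I" and "c \<notin> I" and "b \<noteq> c"
    and supp: "\<And>x y. x \<in> I \<Longrightarrow> y \<notin> insert b (insert c I) \<Longrightarrow> T x y = 0"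
    and u: "0 < u" "u < 1"
  shows "u * T x0 b \<le> exit_transform M X u b c" and "exit_transform M X u b c \<le> 1"
proof -
  interpret prob_space M using mc by (simp add: markov_chain_def)
  define E where "E k = measure M {\<omega>\<in>space M. (\<forall>i\<le>k. X i \<omega> \<in> I) \<and> X (Suc k) \<omega> = b}" for k
  have sums: "(\<lambda>k. u ^ Suc k * E k) sums exit_transform M X u b c"
    unfolding E_def by (rule exit_transform_sums[OF assms])
  have "E 0 = (\<Sum>x\<in>I. (if x = x0 then 1 else 0) * T x b)"
    unfolding E_def markov_killed_step[OF mc \<open>finite I\<close>]
    using markov_initial_mass[OF mc \<open>x0 \<in> I\<close>] by simp
  also have "\<dots> = T x0 b"
    using \<open>finite I\<close> \<open>x0 \<in> I\<close> by (simp add: if_distrib[of "\<lambda>t. t * _"] cong: if_cong)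
  finally have E0: "E 0 = T x0 b" .
  have "(\<Sum>k<1. u ^ Suc k * E k) \<le> exit_transform M X u b c"
    using sum_le_suminf[OF sums_summable[OF sums], of "{..<1}"] sums_unique[OF sums] u by (auto simp: E_def)
  then show "u * T x0 b \<le> exit_transform M X u b c"
    by (simp add: E0)
  show "exit_transform M X u b c \<le> 1"
  proof -
    define Y where "Y \<omega> = indicat_real {\<omega>. passage_time X b \<omega> < passage_time X c \<omega>} \<omega> *\<^sub>R
        epower u (passage_time X b \<omega>)" for \<omega>
    have "Y \<omega> \<le> 1" for \<omega>
      using u by (auto simp: Y_def indicator_def epower_def power_le_one split: enat.split)
    then have "(\<integral>\<omega>. Y \<omega> \<partial>M) \<le> 1"
      by (cases "integrable M Y") (auto intro: integral_le_const simp: not_integrable_integral_eq)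
    then show ?thesis by (simp add: exit_transform_def set_lebesgue_integral_def Y_def)
  qed
qed


section \<open>Nearest-neighbour walks on an interval\<close>

lemma sum_nearest_neighbour:
  assumes "finite J" "x - 1 \<in> J" "x + 1 \<in> J"
  shows "(\<Sum>y\<in>J. nearest_neighbour a x y * h y) = a x * h (x + 1) + (1 - a x) * h (x - 1)"
proof -
  have "(\<Sum>y\<in>J. nearest_neighbour a x y * h y) = (\<Sum>y\<in>{x + 1, x - 1}. nearest_neighbour a x y * h y)"
    using assms by (intro sum.mono_neutral_right) (auto simp: nearest_neighbour_def)
  then show ?thesis by (simp add: nearest_neighbour_def)
qed

lemma walk_exit_harmonic:
  assumes mc: "markov_chain M X 0 (nearest_neighbour a)"
    and lr: "l < 0" "0 < r" "{b, c} = {l, r}"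
    and u: "0 < u" "u < 1"
    and harm: "\<And>x. l < x \<Longrightarrow> x < r \<Longrightarrow> h x = u * (a x * h (x + 1) + (1 - a x) * h (x - 1))"
    and "h c = 0"
  shows "exit_transform M X u b c * h b = h 0"
proof (rule exit_transform_harmonic[OF mc, where I = "{l<..<r}"])
  have J: "insert b (insert c {l<..<r}) = {l..r}"
    using lr by (auto simp: doubleton_eq_iff)
  show "h x = u * (\<Sum>y\<in>insert b (insert c {l<..<r}). nearest_neighbour a x y * h y)"
    if "x \<in> {l<..<r}" for x
    unfolding J using that harm[of x] by (subst sum_nearest_neighbour) auto
  show "nearest_neighbour a x y = 0" if "x \<in> {l<..<r}" "y \<notin> insert b (insert c {l<..<r})" for x y
    using that unfolding J by (auto simp: nearest_neighbour_def)
qed (use lr u \<open>h c = 0\<close> in \<open>auto simp: doubleton_eq_iff\<close>)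

lemma walk_exit_bounds:
  assumes mc: "markov_chain M X 0 (nearest_neighbour a)"
    and lr: "l < 0" "0 < r" "{b, c} = {l, r}"
    and u: "0 < u" "u < 1"
  shows "u * nearest_neighbour a 0 b \<le> exit_transform M X u b c" "exit_transform M X u b c \<le> 1"
proof -
  have J: "insert b (insert c {l<..<r}) = {l..r}"
    using lr by (auto simp: doubleton_eq_iff)
  have supp: "nearest_neighbour a x y = 0"
    if "x \<in> {l<..<r}" "y \<notin> insert b (insert c {l<..<r})" for x y
    using that unfolding J by (auto simp: nearest_neighbour_def)
  show "u * nearest_neighbour a 0 b \<le> exit_transform M X u b c"
    by (rule exit_transform_bounds(1)[OF mc, where I = "{l<..<r}"])
      (use lr u supp in \<open>auto simp: doubleton_eq_iff\<close>)
  show "exit_transform M X u b c \<le> 1"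
    by (rule exit_transform_bounds(2)[OF mc, where I = "{l<..<r}"])
      (use lr u supp in \<open>auto simp: doubleton_eq_iff\<close>)
qed

text \<open>
  The u-harmonic function on \<open>{- 1, 0, 1, \<dots>}\<close> with value \<open>s\<close> at \<open>- 1\<close> and \<open>t\<close> at \<open>0\<close>, obtained by
  solving the harmonic equation at each site for the value at its right neighbour. Index \<open>j\<close> stands for
  the site \<open>j - 1\<close>, so that the left end of the domain has index \<open>0\<close>.
\<close>

fun harmonic_sol :: "real \<Rightarrow> (int \<Rightarrow> real) \<Rightarrow> real \<Rightarrow> real \<Rightarrow> nat \<Rightarrow> real" where
  "harmonic_sol u a s t 0 = s"
| "harmonic_sol u a s t (Suc 0) = t"
| "harmonic_sol u a s t (Suc (Suc j)) =
     (harmonic_sol u a s t (Suc j) - u * (1 - a (int j)) * harmonic_sol u a s t j) / (u * a (int j))"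

lemma harmonic_sol_harmonic:
  fixes a :: "int \<Rightarrow> real" and u s t :: real
  assumes "0 \<le> x" "0 < a x" "0 < u"
  defines "h \<equiv> \<lambda>x. harmonic_sol u a s t (nat (x + 1))"
  shows "h x = u * (a x * h (x + 1) + (1 - a x) * h (x - 1))"
proof -
  obtain j where x: "x = int j" using \<open>0 \<le> x\<close> nonneg_int_cases by blast
  have "nat (x + 1) = Suc j" "nat (x + 1 + 1) = Suc (Suc j)" "nat (x - 1 + 1) = j"
    by (auto simp: x)
  then show ?thesis using assms(2,3) by (simp add: h_def x field_simps)
qed

text \<open>
  A positive value at a site is \<open>u\<close> times an average of its neighbours, hence strictly less than that average. If
  the left neighbour is not larger, the right one must be.
\<close>

lemma harmonic_sol_increasing:
  assumes a: "\<And>x. 0 < a x \<and> a x < 1" and u: "0 < u" "u < 1"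
  shows "0 \<le> harmonic_sol u a 0 1 j \<and> harmonic_sol u a 0 1 j < harmonic_sol u a 0 1 (Suc j)"
proof (induction j)
  case (Suc j)
  let ?s = "harmonic_sol u a 0 1" and ?a = "a (int j)"
  have aj: "0 < ?a" "?a < 1" using a by auto
  have "u * (1 - ?a) * ?s j \<le> u * (1 - ?a) * ?s (Suc j)"
    using Suc u aj by (intro mult_left_mono) auto
  moreover have "u * ?s (Suc j) < ?s (Suc j)" using Suc u by simp
  ultimately have "u * ?a * ?s (Suc j) < ?s (Suc j) - u * (1 - ?a) * ?s j"
    by (simp add: algebra_simps)
  then have "?s (Suc j) < ?s (Suc (Suc j))"
    using u aj by (simp add: pos_less_divide_eq mult.commute)
  then show ?case using Suc by auto
qed simp

lemma harmonic_sol_pos: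
  assumes "\<And>x. 0 < a x \<and> a x < 1" "0 < u" "u < 1"
  shows "0 < harmonic_sol u a 0 1 (Suc j)"
  using harmonic_sol_increasing[where a = a and j = j, OF assms] by linarith

section \<open>Iterates of a measure automorphism\<close>

text \<open>
  A case distinction is needed in the step, since negative powers are iterates of the inverse map: moving
  from a negative exponent towards \<open>0\<close> cancels one application of that inverse.
\<close>

lemma int_iterate_shift:
  assumes bij: "bij_betw S E E" and "e \<in> E"
  shows "int_iterate E S x ((S ^^ n) e) = int_iterate E S (x + int n) e"
  using \<open>e \<in> E\<close>
proof (induction n arbitrary: e)
  case (Suc n)
  have one: "int_iterate E S y (S e) = int_iterate E S (y + 1) e" for y
  proof (cases "0 \<le> y")
    case True
    then have "nat (y + 1) = Suc (nat y)" by simp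
    then show ?thesis using True by (simp add: int_iterate_def funpow_swap1)
  next
    case False
    then have "y = - int (Suc (nat (- y) - 1))" by simp
    then obtain j where y: "y = - int (Suc j)" by blast
    have "inv_into E S (S e) = e"
      using bij Suc.prems by (simp add: bij_betw_def inv_into_f_f)
    then have "int_iterate E S y (S e) = (inv_into E S ^^ j) e"
      by (simp add: int_iterate_def y nat_add_distrib funpow_Suc_right del: funpow.simps)
    moreover have "int_iterate E S (y + 1) e = (inv_into E S ^^ j) e"
      by (simp add: int_iterate_def y)
    ultimately show ?thesis by simp
  qed
  have "S e \<in> E" using bij Suc.prems by (auto simp: bij_betw_def)
  then have "int_iterate E S x ((S ^^ n) (S e)) = int_iterate E S (x + int n) (S e)" by (rule Suc.IH)
  then show ?case using one[of "x + int n"] by (simp add: funpow_swap1 algebra_simps)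
qed simp

lemma funpow_inv_into:
  assumes bij: "bij_betw S E E" and "e \<in> E"
  shows "(S ^^ n) ((inv_into E S ^^ n) e) = e"
  using \<open>e \<in> E\<close>
proof (induction n arbitrary: e)
  case (Suc n)
  have "inv_into E S e \<in> E" "S (inv_into E S e) = e"
    using bij Suc.prems by (auto simp: bij_betw_def inv_into_into f_inv_into_f)
  then show ?case using Suc.IH[of "inv_into E S e"]
    by (simp add: funpow_swap1)
qed simp

lemma measurable_int_iterate:
  assumes "measure_automorphism m S"
  shows "int_iterate (space m) S x \<in> measurable m m"
  using assms by (auto simp: int_iterate_def measure_automorphism_def intro: measurable_compose_n)

lemma distr_funpow:
  assumes "measure_automorphism m S"
  shows "distr m m (S ^^ n) = m"
proof (induction n)
  case 0
  show ?case by (simp add: distr_id[unfolded id_def] id_def)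
next
  case (Suc n)
  have [measurable]: "S \<in> measurable m m" using assms by (simp add: measure_automorphism_def)
  have "distr m m (S ^^ Suc n) = distr (distr m m (S ^^ n)) m S"
    by (subst distr_distr) (auto intro: measurable_compose_n )
  then show ?case using Suc assms by (simp add: measure_automorphism_def comp_def)
qed

section \<open>The stationary environment\<close>

text \<open>
  A single process \<open>X\<close> is observed under all laws \<open>P e\<close>, and it
  always starts at \<open>0\<close>; other starting points are reached by shifting the environment.
\<close>

locale stationary_walk =
  fixes m :: "'e measure" and S :: "'e \<Rightarrow> 'e" and p :: "'e \<Rightarrow> real" and u :: real
    and P :: "'e \<Rightarrow> 'w measure" and X :: "nat \<Rightarrow> 'w \<Rightarrow> int"
  assumes prob: "prob_space m"
    and aut: "measure_automorphism m S"
    and p_measurable [measurable]: "p \<in> borel_measurable m"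
    and p01: "\<And>e. e \<in> space m \<Longrightarrow> 0 < p e \<and> p e < 1"
    and walk: "\<And>e. e \<in> space m \<Longrightarrow> walk_in_environment m S p e (P e) X"
    and u: "0 < u" "u < 1"
begin

abbreviation env :: "'e \<Rightarrow> int \<Rightarrow> real" where
  "env e x \<equiv> p (int_iterate (space m) S x e)"

text \<open>The two basic u-harmonic functions, with the index shift of \<open>harmonic_sol\<close>: \<open>\<phi> e j\<close> is the
  value at the site \<open>j - 1\<close>.\<close>

abbreviation \<phi> :: "'e \<Rightarrow> nat \<Rightarrow> real" where "\<phi> e \<equiv> harmonic_sol u (env e) 0 1"
abbreviation \<psi> :: "'e \<Rightarrow> nat \<Rightarrow> real" where "\<psi> e \<equiv> harmonic_sol u (env e) 1 0"

lemma bij: "bij_betw S (space m) (space m)"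
  and S_measurable [measurable]: "S \<in> measurable m m"
  and inv_measurable [measurable]: "inv_into (space m) S \<in> measurable m m"
  using aut by (auto simp: measure_automorphism_def)

lemma funpow_measurable [measurable]: "S ^^ n \<in> measurable m m"
  by (rule measurable_compose_n[OF S_measurable])

lemma funpow_space: "e \<in> space m \<Longrightarrow> (S ^^ n) e \<in> space m"
  using measurable_space[OF funpow_measurable] by blast

lemma env01: "e \<in> space m \<Longrightarrow> 0 < env e x \<and> env e x < 1"
  using measurable_space[OF measurable_int_iterate[OF aut]] p01 by blast

lemma env_0: "env e 0 = p e"
  by (simp add: int_iterate_def)

lemma env_measurable [measurable]: "(\<lambda>e. env e x) \<in> borel_measurable m"
  by (rule measurable_compose[OF measurable_int_iterate[OF aut] p_measurable])

lemma harmonic_sol_measurable [measurable]: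
  "(\<lambda>e. harmonic_sol u (env e) s t j) \<in> borel_measurable m"
proof (induction j rule: induct_nat_012)
  case (ge2 j)
  note [measurable] = ge2
  show ?case by simp
qed simp_all

lemma \<phi>_pos: "e \<in> space m \<Longrightarrow> 0 < \<phi> e (Suc j)"
  using env01 u by (intro harmonic_sol_pos) auto

lemma chain: "e \<in> space m \<Longrightarrow> markov_chain (P e) X 0 (nearest_neighbour (env e))"
  using walk by (simp add: walk_in_environment_def)

text \<open>
  Seen from \<open>e\<close>, the walk in the environment \<open>(S ^^ n) e\<close> starts at \<open>n\<close>, aims for \<open>n + 1\<close> and has to avoid
  \<open>n - k - 1\<close>. Any solution that vanishes at the latter site, which has index \<open>n - k\<close>, can be used;
  \<open>k = n\<close> calls for \<open>\<phi>\<close> and \<open>k = n - 1\<close> for \<open>\<psi>\<close>.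
\<close>

lemma exit_right_ratio:
  assumes "e \<in> space m" "k \<le> n"
    and zero: "harmonic_sol u (env e) s t (n - k) = 0"
  shows "exit_right P X u k ((S ^^ n) e) * harmonic_sol u (env e) s t (Suc (Suc n)) =
         harmonic_sol u (env e) s t (Suc n)"
proof -
  define h where "h x = harmonic_sol u (env e) s t (nat (x + int n + 1))" for x
  have env_shift: "env ((S ^^ n) e) x = env e (x + int n)" for x
    using int_iterate_shift[OF bij \<open>e \<in> space m\<close>] by simp
  have "exit_transform (P ((S ^^ n) e)) X u 1 (- int k - 1) * h 1 = h 0"
  proof (rule walk_exit_harmonic[OF chain[OF funpow_space[OF \<open>e \<in> space m\<close>]],
        where l = "- int k - 1" and r = 1])
    fix x assume "- int k - 1 < x"
    then have "0 \<le> x + int n" using \<open>k \<le> n\<close> by linarith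
    then show "h x = u * (env ((S ^^ n) e) x * h (x + 1) + (1 - env ((S ^^ n) e) x) * h (x - 1))"
      using harmonic_sol_harmonic[of "x + int n" "env e" u s t] env01[OF \<open>e \<in> space m\<close>] u
      by (simp add: h_def env_shift algebra_simps)
  next
    have "nat (- int k - 1 + int n + 1) = n - k" by linarith
    then show "h (- int k - 1) = 0" unfolding h_def using zero by simp
  qed (use u in auto)
  moreover have "nat (1 + int n + 1) = Suc (Suc n)" "nat (0 + int n + 1) = Suc n" by linarith+
  ultimately show ?thesis by (simp only: exit_right_eq h_def)
qed

text \<open>
  The solution to use here is the combination \<open>h\<close> of \<open>\<phi>\<close> and \<open>\<psi>\<close> that vanishes at \<open>n + 1\<close>; its values at
  \<open>- 1\<close> and \<open>0\<close> can be read off from the initial values of \<open>\<phi>\<close> and \<open>\<psi>\<close>.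
\<close>

lemma exit_left_\<phi>\<psi>:
  assumes "e \<in> space m"
  shows "exit_left P X u n e * \<phi> e (Suc (Suc n)) = - \<psi> e (Suc (Suc n))"
proof -
  define g where "g s t x = harmonic_sol u (env e) s t (nat (x + 1))" for s t x
  define h where "h x = \<phi> e (Suc (Suc n)) * g 1 0 x - \<psi> e (Suc (Suc n)) * g 0 1 x" for x
  have "exit_transform (P e) X u (- 1) (int n + 1) * h (- 1) = h 0"
  proof (rule walk_exit_harmonic[OF chain[OF \<open>e \<in> space m\<close>], where l = "- 1" and r = "int n + 1"])
    fix x :: int assume "- 1 < x"
    then have "g s t x = u * (env e x * g s t (x + 1) + (1 - env e x) * g s t (x - 1))" for s t
      unfolding g_def using env01[OF \<open>e \<in> space m\<close>] u by (intro harmonic_sol_harmonic) auto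
    from this[of 1 0] this[of 0 1]
    show "h x = u * (env e x * h (x + 1) + (1 - env e x) * h (x - 1))"
      unfolding h_def by algebra
  next
    have "nat (int n + 1 + 1) = Suc (Suc n)" by linarith
    then show "h (int n + 1) = 0" by (simp only: h_def g_def) simp
  qed (use u in auto)
  then show ?thesis by (simp add: exit_left_eq h_def g_def)
qed

lemma exit_right_\<phi>:
  assumes "e \<in> space m"
  shows "exit_right P X u n ((S ^^ n) e) * \<phi> e (Suc (Suc n)) = \<phi> e (Suc n)"
  using assms by (intro exit_right_ratio) auto

text \<open>
  After multiplication by \<open>\<phi> (n + 2)\<close>, the value of \<open>\<phi>\<close> at the right end, both products equal the same
  value of \<open>- \<psi>\<close>. The common factor is positive and cancels.
\<close>

lemma exit_exchange:
  assumes "e \<in> space m"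
  shows "exit_left P X u (Suc n) e * exit_right P X u n ((S ^^ Suc n) e) =
         exit_left P X u n e * exit_right P X u (Suc n) ((S ^^ Suc n) e)"
proof -
  let ?\<phi> = "\<phi> e" and ?\<psi> = "\<psi> e" and ?n = "Suc n"
  let ?L = "exit_left P X u (Suc n) e" and ?L' = "exit_left P X u n e"
  let ?R = "exit_right P X u (Suc n) ((S ^^ Suc n) e)" and ?R' = "exit_right P X u n ((S ^^ Suc n) e)"
  have L: "?L * ?\<phi> (Suc (Suc ?n)) = - ?\<psi> (Suc (Suc ?n))" and L': "?L' * ?\<phi> (Suc ?n) = - ?\<psi> (Suc ?n)"
    using exit_left_\<phi>\<psi>[OF assms, of "Suc n"] exit_left_\<phi>\<psi>[OF assms, of n] by (simp_all only:)
  have R: "?R * ?\<phi> (Suc (Suc ?n)) = ?\<phi> (Suc ?n)" by (rule exit_right_\<phi>[OF assms])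
  have R': "?R' * ?\<psi> (Suc (Suc ?n)) = ?\<psi> (Suc ?n)"
    by (rule exit_right_ratio[OF assms]) auto
  have "?L * ?R' * ?\<phi> (Suc (Suc ?n)) = - ?\<psi> (Suc ?n)"
    using L R' by algebra
  also have "\<dots> = ?L' * ?R * ?\<phi> (Suc (Suc ?n))"
    using L' R by algebra
  finally show ?thesis using \<phi>_pos[OF assms, of "Suc ?n"] by (simp del: harmonic_sol.simps)
qed

lemma exit_right_bounds:
  assumes "e \<in> space m"
  shows "u * p e \<le> exit_right P X u n e" "exit_right P X u n e \<le> 1"
  using walk_exit_bounds[OF chain[OF assms] _ _ _ u, of "- int n - 1" 1 1 "- int n - 1"]
  by (auto simp: exit_right_eq nearest_neighbour_def env_0)

lemma exit_left_bounds:
  assumes "e \<in> space m"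
  shows "u * (1 - p e) \<le> exit_left P X u n e" "exit_left P X u n e \<le> 1"
  using walk_exit_bounds[OF chain[OF assms] _ _ _ u, of "- 1" "int n + 1" "- 1" "int n + 1"]
  by (auto simp: exit_left_eq nearest_neighbour_def env_0)

lemma exit_right_pos: "e \<in> space m \<Longrightarrow> 0 < exit_right P X u n e"
  using exit_right_bounds(1)[of e n] p01[of e] u by (meson less_le_trans mult_pos_pos)

lemma exit_left_pos: "e \<in> space m \<Longrightarrow> 0 < exit_left P X u n e"
  using exit_left_bounds(1)[of e n] p01[of e] u by (meson diff_gt_0_iff_gt less_le_trans mult_pos_pos)

lemma exit_right_0: "e \<in> space m \<Longrightarrow> exit_right P X u 0 e = u * p e"
  using exit_right_\<phi>[of e 0] u p01[of e] by (simp add: env_0 field_simps)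

lemma exit_left_0: "e \<in> space m \<Longrightarrow> exit_left P X u 0 e = u * (1 - p e)"
  using exit_left_\<phi>\<psi>[of e 0] u p01[of e] by (simp add: env_0 field_simps)

lemma exit_left_measurable [measurable]: "exit_left P X u n \<in> borel_measurable m"
proof -
  have "exit_left P X u n e = - \<psi> e (Suc (Suc n)) / \<phi> e (Suc (Suc n))" if "e \<in> space m" for e
    using exit_left_\<phi>\<psi>[OF that, of n] \<phi>_pos[OF that, of "Suc n"]
    by (simp add: field_simps del: harmonic_sol.simps)
  then show ?thesis by (subst measurable_cong) (auto simp del: harmonic_sol.simps)
qed

text \<open>
  The quotient formula describes \<open>f[n]\<close> at \<open>(S ^^ n) e\<close>; the inverse of \<open>S ^^ n\<close> carries it back to \<open>e\<close>.
\<close>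

lemma exit_right_measurable [measurable]: "exit_right P X u n \<in> borel_measurable m"
proof -
  let ?T = "inv_into (space m) S ^^ n"
  have T[measurable]: "?T \<in> measurable m m" by (rule measurable_compose_n[OF inv_measurable])
  have "exit_right P X u n e = \<phi> (?T e) (Suc n) / \<phi> (?T e) (Suc (Suc n))" if "e \<in> space m" for e
  proof -
    have T: "?T e \<in> space m" using measurable_space[OF T that] .
    show ?thesis
      using exit_right_\<phi>[OF T, of n] \<phi>_pos[OF T, of "Suc n"] funpow_inv_into[OF bij that, of n]
      by (simp add: eq_divide_eq del: harmonic_sol.simps)
  qed
  moreover have "(\<lambda>e. \<phi> (?T e) j) \<in> borel_measurable m" for j
    by (rule measurable_compose[OF T harmonic_sol_measurable])
  ultimately show ?thesis
    by (subst measurable_cong) (auto simp del: harmonic_sol.simps)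
qed

text \<open>
  One of \<open>p e\<close> and \<open>1 - p e\<close> is at least \<open>1/2\<close>, so the logarithm of the smaller one differs in absolute
  value from that of their quotient by at most \<open>ln 2\<close>. The remaining factor \<open>u\<close> costs the constant \<open>- ln u\<close>,
  and constants are integrable because \<open>m\<close> is finite.
\<close>

lemma integrable_ln_between:
  assumes int: "integrable m (\<lambda>e. ln (p e / (1 - p e)))"
    and [measurable]: "g \<in> borel_measurable m"
    and bounds: "\<And>e. e \<in> space m \<Longrightarrow> u * min (p e) (1 - p e) \<le> g e" "\<And>e. e \<in> space m \<Longrightarrow> g e \<le> 1"
  shows "integrable m (\<lambda>e. ln (g e))"
proof (rule Bochner_Integration.integrable_bound)
  interpret prob_space m by (rule prob)
  show "integrable m (\<lambda>e. \<bar>ln (p e / (1 - p e))\<bar> + (ln 2 - ln u))"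
    using int by auto
  show "AE e in m. norm (ln (g e)) \<le> norm (\<bar>ln (p e / (1 - p e))\<bar> + (ln 2 - ln u))"
  proof (rule AE_I2)
    fix e assume e: "e \<in> space m"
    define r where "r = min (p e) (1 - p e)"
    have pe: "0 < p e" "p e < 1" using p01[OF e] by auto
    have r: "0 < r" using pe by (simp add: r_def)
    have "- ln r \<le> \<bar>ln (p e / (1 - p e))\<bar> + ln 2"
    proof -
      have d: "ln (p e / (1 - p e)) = ln (p e) - ln (1 - p e)" using pe by (simp add: ln_div)
      have half: "- ln 2 \<le> ln t" if "1 / 2 \<le> t" for t :: real
        using that ln_le_cancel_iff[of "1/2" t] by (simp add: ln_div)
      show ?thesis using half[of "p e"] half[of "1 - p e"]
        unfolding d r_def min_def by (auto simp: abs_if)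
    qed
    moreover have "0 < u * r" "u * r \<le> g e" using r u bounds(1)[OF e] by (auto simp: r_def)
    then have "ln (u * r) \<le> ln (g e)" "ln (g e) \<le> 0"
      using bounds(2)[OF e] by (auto simp: ln_le_zero_iff)
    moreover have "ln (u * r) = ln u + ln r" using r u by (simp add: ln_mult)
    moreover have "ln u < 0" "0 < ln (2::real)" using u by auto
    ultimately show "norm (ln (g e)) \<le> norm (\<bar>ln (p e / (1 - p e))\<bar> + (ln 2 - ln u))"
      by simp
  qed
  show "(\<lambda>e. ln (g e)) \<in> borel_measurable m" by measurable
qed

lemma exit_ge_min:
  assumes "e \<in> space m"
  shows "u * min (p e) (1 - p e) \<le> exit_right P X u n e"
    and "u * min (p e) (1 - p e) \<le> exit_left P X u n e"
proof -
  have "u * min (p e) (1 - p e) \<le> u * p e" "u * min (p e) (1 - p e) \<le> u * (1 - p e)"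
    using u by (auto intro: mult_left_mono)
  then show "u * min (p e) (1 - p e) \<le> exit_right P X u n e" "u * min (p e) (1 - p e) \<le> exit_left P X u n e"
    using exit_right_bounds(1)[OF assms, of n] exit_left_bounds(1)[OF assms, of n] by linarith+
qed

context
  assumes int: "integrable m (\<lambda>e. ln (p e / (1 - p e)))"
begin

lemma integrable_ln_exit_right: "integrable m (\<lambda>e. ln (exit_right P X u n e))"
  by (intro integrable_ln_between[OF int] exit_right_measurable exit_ge_min exit_right_bounds)

lemma integrable_ln_exit_left: "integrable m (\<lambda>e. ln (exit_left P X u n e))"
  by (intro integrable_ln_between[OF int] exit_left_measurable exit_ge_min exit_left_bounds)

text \<open>
  Induction on \<open>n\<close>: by \<open>exit_exchange\<close> the difference of the two integrals is the same for \<open>n\<close> and \<open>n + 1\<close>.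
  The shift by \<open>S ^^ Suc n\<close> disappears on integration.
\<close>

lemma integral_ln_exit:
  "(\<integral>e. ln (exit_right P X u n e) \<partial>m) =
     (\<integral>e. ln (exit_left P X u n e) \<partial>m) + (\<integral>e. ln (p e / (1 - p e)) \<partial>m)"
proof (induction n)
  case 0
  have "(\<integral>e. ln (exit_right P X u 0 e) \<partial>m) =
      (\<integral>e. ln (exit_left P X u 0 e) + ln (p e / (1 - p e)) \<partial>m)"
  proof (intro Bochner_Integration.integral_cong refl)
    fix e assume "e \<in> space m"
    then show "ln (exit_right P X u 0 e) = ln (exit_left P X u 0 e) + ln (p e / (1 - p e))"
      using p01[of e] u by (simp add: exit_right_0 exit_left_0 ln_mult ln_div)
  qed
  then show ?case using integrable_ln_exit_left int by simp
next
  case (Suc n)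
  let ?T = "S ^^ Suc n"
  let ?r = "\<lambda>k e. ln (exit_right P X u k e)" and ?l = "\<lambda>k e. ln (exit_left P X u k e)"
  have inv: "integrable m (\<lambda>e. ?r k (?T e))" "(\<integral>e. ?r k (?T e) \<partial>m) = (\<integral>e. ?r k e \<partial>m)" for k
    using integrable_distr[of ?T m m "?r k"] integral_distr[of ?T m m "?r k"]
      integrable_ln_exit_right[of k]
    unfolding distr_funpow[OF aut] by (auto simp del: funpow.simps)
  have "(\<integral>e. ?l (Suc n) e + ?r n (?T e) \<partial>m) = (\<integral>e. ?l n e + ?r (Suc n) (?T e) \<partial>m)"
  proof (intro Bochner_Integration.integral_cong refl)
    fix e assume e: "e \<in> space m"
    have "exit_left P X u i e > 0" "exit_right P X u i (?T e) > 0" for i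
      using e funpow_space exit_left_pos exit_right_pos by blast+
    then show "?l (Suc n) e + ?r n (?T e) = ?l n e + ?r (Suc n) (?T e)"
      using exit_exchange[OF e, of n] by (simp add: ln_mult_pos[symmetric] del: funpow.simps)
  qed
  then have "(\<integral>e. ?l (Suc n) e \<partial>m) + (\<integral>e. ?r n e \<partial>m) = (\<integral>e. ?l n e \<partial>m) + (\<integral>e. ?r (Suc n) e \<partial>m)"
    using inv integrable_ln_exit_left by (simp del: funpow.simps)
  then show ?case using Suc by linarith
qed

end

end

theorem proposition1:
  fixes m :: "'e measure" and S :: "'e \<Rightarrow> 'e" and p :: "'e \<Rightarrow> real" and u :: real
    and P :: "'e \<Rightarrow> 'w measure" and X :: "nat \<Rightarrow> 'w \<Rightarrow> int"
  defines "f \<equiv> exit_right P X u" and "f' \<equiv> exit_left P X u"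
  assumes "prob_space m"
    and "measure_automorphism m S"
    and "p \<in> borel_measurable m"
    and "\<And>e. e \<in> space m \<Longrightarrow> 0 < p e \<and> p e < 1"
    and "\<And>e. e \<in> space m \<Longrightarrow> walk_in_environment m S p e (P e) X"
    and "0 < u" and "u < 1"
  shows "(\<forall>n\<ge>1. \<forall>e\<in>space m.
            f' n e * f (n - 1) ((S ^^ n) e) = f' (n - 1) e * f n ((S ^^ n) e)) \<and>
         (integrable m (\<lambda>e. ln (p e / (1 - p e))) \<longrightarrow>
            (\<forall>n. integrable m (\<lambda>e. ln (f n e)) \<and>
                 integrable m (\<lambda>e. ln (f' n e)) \<and>
                 (\<integral>e. ln (f n e) \<partial>m) =
                   (\<integral>e. ln (f' n e) \<partial>m) + (\<integral>e. ln (p e / (1 - p e)) \<partial>m)))"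
proof -
  interpret stationary_walk m S p u P X
    using assms(3-9) by (rule stationary_walk.intro)
  show ?thesis
    unfolding f_def f'_def
  proof (rule conjI)
    show "\<forall>n\<ge>1. \<forall>e\<in>space m. exit_left P X u n e * exit_right P X u (n - 1) ((S ^^ n) e) =
        exit_left P X u (n - 1) e * exit_right P X u n ((S ^^ n) e)"
    proof (intro allI impI ballI)
      fix n :: nat and e assume "1 \<le> n" and e: "e \<in> space m"
      then have "n = Suc (n - 1)" by simp
      then show "exit_left P X u n e * exit_right P X u (n - 1) ((S ^^ n) e) =
          exit_left P X u (n - 1) e * exit_right P X u n ((S ^^ n) e)"
        using exit_exchange[OF e, of "n - 1"] by metis
    qed
    show "integrable m (\<lambda>e. ln (p e / (1 - p e))) \<longrightarrow>
        (\<forall>n. integrable m (\<lambda>e. ln (exit_right P X u n e)) \<and>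
             integrable m (\<lambda>e. ln (exit_left P X u n e)) \<and>
             (\<integral>e. ln (exit_right P X u n e) \<partial>m) =
               (\<integral>e. ln (exit_left P X u n e) \<partial>m) + (\<integral>e. ln (p e / (1 - p e)) \<partial>m))"
      using integrable_ln_exit_right integrable_ln_exit_left integral_ln_exit by blast
  qed
qed

end
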